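(* Let $(X,\mathcal{A},\lambda)$ be a $\sigma$-finite measure space and $T:X\to X$ a null-preserving map. The following are equivalent: (i) the system $(X,\mathcal{A},\lambda,T)$ is exact; (ii) the system has no nontrivial corridors; (iii) no two sets of positive measure remain separated, i.e. if $A,B\in\mathcal{A}$ remain separated, then $\lambda(A)=0$ or $\lambda(B)=0$.
   Context: For $A,B\in\mathcal{A}$ write $A\overset{.}{\subseteq}B$ if $\lambda(A\setminus B)=0$ and $A\overset{.}{=}B$ if $\lambda(A\triangle B)=0$. A measurable map $T:X\to X$ is null-preserving if $\lambda(A)=0$ implies $\lambda(T^{-1}A)=0$ for $A\in\mathcal{A}$. A tail set is a set $A\in\mathcal{A}$ with $A\overset{.}{=}B$ for some $B\in\bigcap_{n\ge0}T^{-n}\mathcal{A}$. The system is exact if every tail set $A$ satisfies $\lambda(A)=0$ or $\lambda(A^c)=0$. A sequence $(A_n)_{n\ge0}$ in $\mathcal{A}$ is a corridor with entrance $A\in\mathcal{A}$ if $A\overset{.}{=}T^{-n}A_n$ for all $n\ge0$; the corridor is nontrivial if its entrance satisfies $\lambda(A)>0$ and $\lambda(A^c)>0$. Sets $A,B\in\mathcal{A}$ remain separated if for every $n\ge0$ there is $A_n\in\mathcal{A}$ with $A\overset{.}{\subseteq}T^{-n}A_n$ and $B\overset{.}{\subseteq}T^{-n}A_n^c$. *)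

theory Defs
  imports "HOL-Analysis.Analysis"
begin

definition subset_mod_null :: "'a measure \<Rightarrow> 'a set \<Rightarrow> 'a set \<Rightarrow> bool" where
  "subset_mod_null M A B \<longleftrightarrow> emeasure M (A - B) = 0"

definition eq_mod_null :: "'a measure \<Rightarrow> 'a set \<Rightarrow> 'a set \<Rightarrow> bool" where
  "eq_mod_null M A B \<longleftrightarrow> emeasure M ((A - B) \<union> (B - A)) = 0"

text \<open>The set \<open>T\<^sup>-\<^sup>n A\<close>. The underlying space is \<open>space M\<close>, which need not be the
  whole type, so preimages are intersected with it and the complement \<open>A\<^sup>c\<close> is
  written \<open>space M - A\<close> below.\<close>

definition preimage_iter :: "'a measure \<Rightarrow> ('a \<Rightarrow> 'a) \<Rightarrow> nat \<Rightarrow> 'a set \<Rightarrow> 'a set" where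
  "preimage_iter M T n A = (T ^^ n) -` A \<inter> space M"

definition null_preserving :: "'a measure \<Rightarrow> ('a \<Rightarrow> 'a) \<Rightarrow> bool" where
  "null_preserving M T \<longleftrightarrow>
     T \<in> measurable M M \<and>
     (\<forall>A\<in>sets M. emeasure M A = 0 \<longrightarrow> emeasure M (T -` A \<inter> space M) = 0)"

definition tail_set :: "'a measure \<Rightarrow> ('a \<Rightarrow> 'a) \<Rightarrow> 'a set \<Rightarrow> bool" where
  "tail_set M T A \<longleftrightarrow>
     A \<in> sets M \<and> (\<exists>B \<in> (\<Inter>n. preimage_iter M T n ` sets M). eq_mod_null M A B)"

definition exact_system :: "'a measure \<Rightarrow> ('a \<Rightarrow> 'a) \<Rightarrow> bool" where
  "exact_system M T \<longleftrightarrow>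
     (\<forall>A. tail_set M T A \<longrightarrow> emeasure M A = 0 \<or> emeasure M (space M - A) = 0)"

definition corridor_with_entrance ::
    "'a measure \<Rightarrow> ('a \<Rightarrow> 'a) \<Rightarrow> (nat \<Rightarrow> 'a set) \<Rightarrow> 'a set \<Rightarrow> bool" where
  "corridor_with_entrance M T C A \<longleftrightarrow>
     (\<forall>n. C n \<in> sets M) \<and> A \<in> sets M \<and> (\<forall>n. eq_mod_null M A (preimage_iter M T n (C n)))"

text \<open>The case \<open>n = 0\<close> determines the entrance of a corridor up to a null set, so
  nontriviality does not depend on which entrance is chosen.\<close>

definition nontrivial_corridor ::
    "'a measure \<Rightarrow> ('a \<Rightarrow> 'a) \<Rightarrow> (nat \<Rightarrow> 'a set) \<Rightarrow> bool" where
  "nontrivial_corridor M T C \<longleftrightarrow>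
     (\<exists>A. corridor_with_entrance M T C A \<and> emeasure M A > 0 \<and> emeasure M (space M - A) > 0)"

definition remain_separated :: "'a measure \<Rightarrow> ('a \<Rightarrow> 'a) \<Rightarrow> 'a set \<Rightarrow> 'a set \<Rightarrow> bool" where
  "remain_separated M T A B \<longleftrightarrow>
     A \<in> sets M \<and> B \<in> sets M \<and>
     (\<forall>n. \<exists>C\<in>sets M. subset_mod_null M A (preimage_iter M T n C) \<and>
                     subset_mod_null M B (preimage_iter M T n (space M - C)))"

end

theory Submission
  imports Defs
begin

text \<open>If \<open>A\<close> and \<open>B\<close> are separated at every time \<open>n\<close> by a set \<open>C n\<close>, then the set of points
  whose orbit satisfies \<open>T\<^sup>n x \<in> C n\<close> infinitely often belongs to every \<open>T\<^sup>-\<^sup>k \<A>\<close>, because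
  discarding the times before \<open>k\<close> does not change it. Modulo null sets it contains \<open>A\<close> and misses
  \<open>B\<close>, so exactness forces \<open>A\<close> or \<open>B\<close> to be null. Conversely, a nontrivial corridor keeps its
  entrance separated from the complement of the entrance, and a nontrivial tail set is the entrance
  of a nontrivial corridor.\<close>

lemma sets_preimage_iter:
  assumes "T \<in> measurable M M" and "A \<in> sets M"
  shows "preimage_iter M T n A \<in> sets M"
  using measurable_sets[OF measurable_compose_n[OF assms(1)] assms(2)]
  by (simp add: preimage_iter_def)

lemma funpow_in_space:
  assumes "T \<in> measurable M M" and "x \<in> space M"
  shows "(T ^^ n) x \<in> space M"
  using measurable_space[OF measurable_compose_n[OF assms(1)] assms(2)] .

lemma preimage_iter_complement:
  assumes "T \<in> measurable M M"
  shows "preimage_iter M T n (space M - C) = space M - preimage_iter M T n C"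
  using funpow_in_space[OF assms] by (auto simp: preimage_iter_def)

text \<open>The sets \<open>C n\<close> are arbitrary, and membership in the tail holds exactly,
  with no null sets involved. The argument is pure reindexing, since a limsup ignores finitely many
  times.\<close>

lemma limsup_preimage_iter_in_tail:
  assumes T: "T \<in> measurable M M" and C: "\<And>n. C n \<in> sets M"
  shows "(\<Inter>n. \<Union>m\<in>{n..}. preimage_iter M T m (C m)) \<in> (\<Inter>k. preimage_iter M T k ` sets M)"
proof
  fix k
  \<comment> \<open>Time \<open>m\<close> along the orbit of \<open>(T ^^ k) x\<close> is time
    \<open>m + k\<close> along the orbit of \<open>x\<close>; hence the shifted index in
    \<open>C\<close>.\<close>
  let ?D = "\<Inter>n. \<Union>m\<in>{n..}. preimage_iter M T m (C (m + k))"
  have iter: "(T ^^ m) ((T ^^ k) x) = (T ^^ (m + k)) x" for m x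
    by (simp add: funpow_add)
  have "(\<Inter>n. \<Union>m\<in>{n..}. preimage_iter M T m (C m)) = preimage_iter M T k ?D"
  proof (intro set_eqI iffI)
    fix x assume x: "x \<in> (\<Inter>n. \<Union>m\<in>{n..}. preimage_iter M T m (C m))"
    then have xs: "x \<in> space M" by (auto simp: preimage_iter_def)
    have "(T ^^ k) x \<in> (\<Union>m\<in>{n..}. preimage_iter M T m (C (m + k)))" for n
    proof -
      \<comment> \<open>Asking for \<open>n + k\<close> rather than \<open>n\<close> makes
        \<open>m - k\<close> a genuine subtraction and keeps it at least \<open>n\<close>.\<close>
      from x obtain m where "m \<ge> n + k" "(T ^^ m) x \<in> C m"
        by (auto simp: preimage_iter_def)
      then have "m - k \<ge> n" "(T ^^ (m - k)) ((T ^^ k) x) \<in> C (m - k + k)"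
        by (simp_all add: iter)
      with funpow_in_space[OF T xs] show ?thesis
        by (auto simp: preimage_iter_def)
    qed
    with xs show "x \<in> preimage_iter M T k ?D"
      by (auto simp: preimage_iter_def)
  next
    fix x assume x: "x \<in> preimage_iter M T k ?D"
    have "x \<in> (\<Union>m\<in>{n..}. preimage_iter M T m (C m))" for n
    proof -
      from x obtain m where "m \<ge> n" "(T ^^ (m + k)) x \<in> C (m + k)" "x \<in> space M"
        by (auto simp: preimage_iter_def iter)
      then show ?thesis
        by (intro UN_I[of "m + k"]) (auto simp: preimage_iter_def)
    qed
    then show "x \<in> (\<Inter>n. \<Union>m\<in>{n..}. preimage_iter M T m (C m))" by blast
  qed
  moreover have "?D \<in> sets M"
    using sets_preimage_iter[OF T C] by (intro sets.countable_INT sets.countable_UN') auto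
  ultimately show "(\<Inter>n. \<Union>m\<in>{n..}. preimage_iter M T m (C m)) \<in> preimage_iter M T k ` sets M"
    by blast
qed

lemma exact_system_not_remain_separated:
  assumes T: "T \<in> measurable M M" and ex: "exact_system M T"
    and sep: "remain_separated M T A B"
  shows "emeasure M A = 0 \<or> emeasure M B = 0"
proof -
  from sep have AB: "A \<in> sets M" "B \<in> sets M" by (auto simp: remain_separated_def)
  from sep obtain C where C: "\<And>n. C n \<in> sets M"
    and AC: "\<And>n. subset_mod_null M A (preimage_iter M T n (C n))"
    and BC: "\<And>n. subset_mod_null M B (preimage_iter M T n (space M - C n))"
    unfolding remain_separated_def by metis
  let ?P = "\<lambda>n. preimage_iter M T n (C n)"
  have P: "?P n \<in> sets M" for n using sets_preimage_iter[OF T C] .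
  define E where "E = (\<Inter>n. \<Union>m\<in>{n..}. ?P m)"
  have E: "E \<in> sets M"
    unfolding E_def using P by (intro sets.countable_INT sets.countable_UN') auto
  have "A - ?P n \<in> null_sets M" for n
    using AC[of n] AB P[of n] by (auto simp: subset_mod_null_def null_sets_def)
  then have "(\<Union>n. A - ?P n) \<in> null_sets M" by (rule null_sets_UN)
  \<comment> \<open>A point outside the limsup misses \<open>?P m\<close> for all large
    \<open>m\<close>, hence at least one of them.\<close>
  moreover have "A - E \<subseteq> (\<Union>n. A - ?P n)" by (auto simp: E_def)
  ultimately have AE: "A - E \<in> null_sets M" using AB E null_sets_subset by blast
  have "B \<inter> ?P n \<in> null_sets M" for n
  proof -
    have "B - (space M - ?P n) = B \<inter> ?P n"
      using sets.sets_into_space[OF AB(2)] by auto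
    then show ?thesis
      using BC[of n] AB P[of n]
      by (auto simp: subset_mod_null_def null_sets_def preimage_iter_complement[OF T])
  qed
  then have "(\<Union>n. B \<inter> ?P n) \<in> null_sets M" by (rule null_sets_UN)
  moreover have "B \<inter> E \<subseteq> (\<Union>n. B \<inter> ?P n)" by (auto simp: E_def)
  ultimately have BE: "B \<inter> E \<in> null_sets M" using AB E null_sets_subset by blast
  \<comment> \<open>\<open>E\<close> lies in the tail exactly, so it serves as its own
    witness.\<close>
  have "tail_set M T E"
    unfolding tail_set_def
  proof (intro conjI bexI)
    show "eq_mod_null M E E" by (simp add: eq_mod_null_def)
    show "E \<in> (\<Inter>n. preimage_iter M T n ` sets M)"
      unfolding E_def by (rule limsup_preimage_iter_in_tail[OF T C])
  qed (fact E)
  then consider "E \<in> null_sets M" | "space M - E \<in> null_sets M"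
    using ex E by (auto simp: exact_system_def null_sets_def)
  then show ?thesis
  proof cases
    case 1
    with AE have "(A - E) \<union> E \<in> null_sets M" by (rule null_sets.Un)
    then have "A \<in> null_sets M" using AB null_sets_subset by blast
    then show ?thesis by auto
  next
    case 2
    with BE have "(B \<inter> E) \<union> (space M - E) \<in> null_sets M" by (rule null_sets.Un)
    moreover have "B \<subseteq> (B \<inter> E) \<union> (space M - E)"
      using sets.sets_into_space[OF AB(2)] by auto
    ultimately have "B \<in> null_sets M" using AB null_sets_subset by blast
    then show ?thesis by auto
  qed
qed

text \<open>The corridor supplies the separating sets itself: the two halves of the null symmetric
  difference of \<open>A\<close> and the preimage of \<open>C n\<close> are the two separation
  conditions at time \<open>n\<close>.\<close>

lemma corridor_remain_separated:
  assumes T: "T \<in> measurable M M" and cor: "corridor_with_entrance M T C A"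
  shows "remain_separated M T A (space M - A)"
  unfolding remain_separated_def
proof (intro conjI allI)
  from cor show A: "A \<in> sets M" by (simp add: corridor_with_entrance_def)
  then show "space M - A \<in> sets M" by auto
  fix n
  let ?P = "preimage_iter M T n (C n)"
  from cor have C: "C n \<in> sets M" by (simp add: corridor_with_entrance_def)
  have P: "?P \<in> sets M" using sets_preimage_iter[OF T C] .
  have N: "(A - ?P) \<union> (?P - A) \<in> null_sets M"
    using cor A P by (auto simp: corridor_with_entrance_def eq_mod_null_def null_sets_def)
  have "A - ?P \<in> null_sets M"
    using null_sets_subset[OF N, of "A - ?P"] A P by blast
  moreover have "?P - A \<in> null_sets M"
    using null_sets_subset[OF N, of "?P - A"] A P by blast
  moreover have "(space M - A) - (space M - ?P) = ?P - A"
    by (auto simp: preimage_iter_def)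
  ultimately show "\<exists>D\<in>sets M. subset_mod_null M A (preimage_iter M T n D) \<and>
      subset_mod_null M (space M - A) (preimage_iter M T n (space M - D))"
    using C by (intro bexI[of _ "C n"])
      (auto simp: subset_mod_null_def preimage_iter_complement[OF T])
qed

text \<open>The one set \<open>B\<close> equal to \<open>A\<close> modulo null sets is an
  \<open>n\<close>-th preimage for every \<open>n\<close>; choosing a set \<open>C n\<close> that
  realises each of these preimages gives the corridor.\<close>

lemma tail_set_entrance:
  assumes "tail_set M T A"
  obtains C where "corridor_with_entrance M T C A"
proof -
  from assms obtain B where A: "A \<in> sets M" and AB: "eq_mod_null M A B"
    and "\<forall>n. B \<in> preimage_iter M T n ` sets M"
    by (auto simp: tail_set_def)
  then obtain C where "\<And>n. C n \<in> sets M" "\<And>n. B = preimage_iter M T n (C n)"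
    unfolding image_iff by metis
  with A AB have "corridor_with_entrance M T C A"
    unfolding corridor_with_entrance_def by metis
  then show thesis by (rule that)
qed

theorem theorem5p4:
  fixes M :: "'a measure" and T :: "'a \<Rightarrow> 'a"
  assumes "sigma_finite_measure M"
    and "null_preserving M T"
  shows "(exact_system M T \<longleftrightarrow> (\<nexists>C. nontrivial_corridor M T C)) \<and>
         ((\<nexists>C. nontrivial_corridor M T C) \<longleftrightarrow>
            (\<forall>A\<in>sets M. \<forall>B\<in>sets M. remain_separated M T A B \<longrightarrow>
               emeasure M A = 0 \<or> emeasure M B = 0))"
    (is "(?ex \<longleftrightarrow> ?nocor) \<and> (_ \<longleftrightarrow> ?nosep)")
proof -
  have T: "T \<in> measurable M M" using assms(2) by (simp add: null_preserving_def)
  \<comment> \<open>Both equivalences follow from the cycle \<open>?ex\<close>,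
    \<open>?nosep\<close>, \<open>?nocor\<close>, \<open>?ex\<close> of implications.\<close>
  have "?ex \<Longrightarrow> ?nosep"
    using exact_system_not_remain_separated[OF T] by blast
  moreover have ?nocor if sep: ?nosep
  proof
    assume "\<exists>C. nontrivial_corridor M T C"
    then obtain C A where cor: "corridor_with_entrance M T C A"
      and pos: "emeasure M A > 0" "emeasure M (space M - A) > 0"
      by (auto simp: nontrivial_corridor_def)
    have "remain_separated M T A (space M - A)"
      by (rule corridor_remain_separated[OF T cor])
    moreover from this have "A \<in> sets M" "space M - A \<in> sets M"
      by (simp_all add: remain_separated_def)
    ultimately have "emeasure M A = 0 \<or> emeasure M (space M - A) = 0"
      using sep by blast
    with pos show False by auto
  qed
  moreover have ?ex if nocor: ?nocor
    unfolding exact_system_def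
  proof (intro allI impI)
    fix A assume "tail_set M T A"
    then obtain C where "corridor_with_entrance M T C A" by (rule tail_set_entrance)
    with nocor show "emeasure M A = 0 \<or> emeasure M (space M - A) = 0"
      unfolding nontrivial_corridor_def by (metis gr_zeroI)
  qed
  ultimately show ?thesis by blast
qed

end
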